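(* Let $\mathcal L$ be a finite lattice and let $(\mathcal L,w)$ be a cover-weighted lattice. 1. Let $r:\mathcal L\to\mathbb R_{\ge0}$ satisfy the rank axioms (R1)–(R3). Define $w_r([A,B])=r(B)-r(A)$ for every cover $A\lessdot B$. Then $(\mathcal L,w_r)$ is a cover-weighted lattice satisfying the interval-weight axioms (IW1) and (IW2). 2. Suppose $(\mathcal L,w)$ satisfies (IW1) and (IW2). Define $r_w(A)=\sum_{i=1}^m w([X_{i-1},X_i])$ for any maximal chain $\mathbf 0=X_0\lessdot\cdots\lessdot X_m=A$. Then $r_w$ is well defined and satisfies (R1)–(R3). 3. In these situations, $w_{r_w}=w$ and $r_{w_r}=r$.
   Context: $\mathcal L$ has least element $\mathbf 0$ and height function $\mathrm h$. A cover-weighted lattice $(\mathcal L,w)$ is a lattice together with a function $w$ assigning a value $w([A,B])\in\mathbb R_{\ge0}$ to each cover $A\lessdot B$. Interval-weight axioms: - (IW1) For every interval $[A,B]$ and every maximal chain $A=X_0\lessdot\cdots\lessdot X_m=B$, the sum $\sum_{i=1}^m w([X_{i-1},X_i])$ is the same; this common value is denoted $w([A,B])$. - (IW2) (IW1) holds, and $w([A,X\vee A])\le w([A\wedge X,X])$ for all $A,X\in\mathcal L$. Rank axioms for $r:\mathcal L\to\mathbb R$, for some $t\ge0$ and all $A,B$: - (R1) $0\le r(A)\le t\,\mathrm h(A)$; - (R2) $A\le B$ implies $r(A)\le r(B)$; - (R3) $r(A)-r(A\wedge B)\ge r(A\vee B)-r(B)$. *)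

theory Defs
  imports Complex_Main
begin

definition covers :: "'a::order \<Rightarrow> 'a \<Rightarrow> bool" (infix "\<lessdot>" 50) where
  "A \<lessdot> B \<longleftrightarrow> A < B \<and> \<not> (\<exists>C. A < C \<and> C < B)"

text \<open>Maximal chains of the interval from \<open>A\<close> to \<open>B\<close>; only the values \<open>X 0, \<dots>, X m\<close> matter.\<close>

definition maximal_chain :: "'a::order \<Rightarrow> 'a \<Rightarrow> nat \<Rightarrow> (nat \<Rightarrow> 'a) \<Rightarrow> bool" where
  "maximal_chain A B m X \<longleftrightarrow> X 0 = A \<and> X m = B \<and> (\<forall>i\<in>{1..m}. X (i - 1) \<lessdot> X i)"

text \<open>The lattice need not be graded: the height is the largest length of a chain from the
  least element.\<close>

definition height :: "'a::{finite,bounded_lattice_bot} \<Rightarrow> nat" where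
  "height A = Max {m. \<exists>X. X 0 = bot \<and> X m = A \<and> (\<forall>i\<in>{1..m}. X (i - 1) < X i)}"

text \<open>A cover weight is a binary function of which only the values on pairs \<open>A \<lessdot> B\<close> are
  meaningful.\<close>

definition cover_weighted :: "('a::lattice \<Rightarrow> 'a \<Rightarrow> real) \<Rightarrow> bool" where
  "cover_weighted w \<longleftrightarrow> (\<forall>A B. A \<lessdot> B \<longrightarrow> 0 \<le> w A B)"

definition chain_weight :: "('a \<Rightarrow> 'a \<Rightarrow> real) \<Rightarrow> nat \<Rightarrow> (nat \<Rightarrow> 'a) \<Rightarrow> real" where
  "chain_weight w m X = (\<Sum>i=1..m. w (X (i - 1)) (X i))"

definition IW1 :: "('a::lattice \<Rightarrow> 'a \<Rightarrow> real) \<Rightarrow> bool" where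
  "IW1 w \<longleftrightarrow> (\<forall>A B m X n Y. A \<le> B \<and> maximal_chain A B m X \<and> maximal_chain A B n Y
     \<longrightarrow> chain_weight w m X = chain_weight w n Y)"

definition interval_weight :: "('a::lattice \<Rightarrow> 'a \<Rightarrow> real) \<Rightarrow> 'a \<Rightarrow> 'a \<Rightarrow> real" where
  "interval_weight w A B = (THE s. \<exists>m X. maximal_chain A B m X \<and> s = chain_weight w m X)"

definition IW2 :: "('a::lattice \<Rightarrow> 'a \<Rightarrow> real) \<Rightarrow> bool" where
  "IW2 w \<longleftrightarrow> IW1 w \<and>
     (\<forall>A X. interval_weight w A (sup X A) \<le> interval_weight w (inf A X) X)"

definition R1 :: "real \<Rightarrow> ('a::{finite,bounded_lattice_bot} \<Rightarrow> real) \<Rightarrow> bool" where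
  "R1 t r \<longleftrightarrow> (\<forall>A. 0 \<le> r A \<and> r A \<le> t * real (height A))"

definition R2 :: "('a::lattice \<Rightarrow> real) \<Rightarrow> bool" where
  "R2 r \<longleftrightarrow> (\<forall>A B. A \<le> B \<longrightarrow> r A \<le> r B)"

definition R3 :: "('a::lattice \<Rightarrow> real) \<Rightarrow> bool" where
  "R3 r \<longleftrightarrow> (\<forall>A B. r A - r (inf A B) \<ge> r (sup A B) - r B)"

definition rank_function :: "('a::{finite,bounded_lattice_bot} \<Rightarrow> real) \<Rightarrow> bool" where
  "rank_function r \<longleftrightarrow> (\<exists>t\<ge>0. R1 t r) \<and> R2 r \<and> R3 r"

definition weight_of_rank :: "('a \<Rightarrow> real) \<Rightarrow> 'a \<Rightarrow> 'a \<Rightarrow> real" where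
  "weight_of_rank r A B = r B - r A"

definition rank_of_weight :: "('a::bounded_lattice_bot \<Rightarrow> 'a \<Rightarrow> real) \<Rightarrow> 'a \<Rightarrow> real" where
  "rank_of_weight w A = (THE s. \<exists>m X. maximal_chain bot A m X \<and> s = chain_weight w m X)"

end

theory Submission imports Defs begin

text \<open>Call \<open>r\<close> a potential of \<open>w\<close> if \<open>w([A,B]) = r(B) - r(A)\<close> on covers. Weights along maximal
  chains then telescope, so (IW1) is automatic and the same formula holds on every interval; hence
  nonnegativity of \<open>w\<close> becomes (R2) and (IW2) becomes (R3). Since only \<open>\<zero>\<close> has height \<open>0\<close>,
  finiteness reduces (R1) to \<open>r \<ge> 0\<close> and \<open>r(\<zero>) = 0\<close>. Conversely, under (IW1) the function \<open>r\<^sub>w\<close>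
  is a potential of \<open>w\<close>, and it is the only one vanishing at \<open>\<zero>\<close>.\<close>

definition strict_chain :: "'a::order \<Rightarrow> 'a \<Rightarrow> nat \<Rightarrow> (nat \<Rightarrow> 'a) \<Rightarrow> bool" where
  "strict_chain A B m X \<longleftrightarrow> X 0 = A \<and> X m = B \<and> (\<forall>i\<in>{1..m}. X (i - 1) < X i)"

lemma strict_chain_imp_strict_mono_on:
  assumes "strict_chain A B m X"
  shows "strict_mono_on {..m} X"
proof (rule strict_mono_onI)
  fix i j assume "i \<in> {..m}" "j \<in> {..m}" "i < j"
  have step: "X k < X (Suc k)" if "Suc k \<le> m" for k
    using assms that by (auto simp: strict_chain_def dest: bspec[of _ _ "Suc k"])
  have "j \<le> m \<longrightarrow> X i < X j"
    using \<open>i < j\<close> by (induction rule: less_Suc_induct) (auto intro: step less_trans)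
  with \<open>j \<in> {..m}\<close> show "X i < X j" by simp
qed

lemma strict_chain_in_interval:
  assumes "strict_chain A B m X" and "i \<le> m"
  shows "X i \<in> {A..B}"
proof -
  have "X 0 \<le> X i" "X i \<le> X m"
    using strict_mono_on_leD[OF strict_chain_imp_strict_mono_on[OF assms(1)]] assms(2) by auto
  then show ?thesis using assms(1) by (simp add: strict_chain_def)
qed

lemma strict_chain_length_less_card:
  assumes "strict_chain A B m X" and "finite {A..B}"
  shows "m < card {A..B}"
proof -
  have "card {..m} \<le> card {A..B}"
    using strict_mono_on_imp_inj_on[OF strict_chain_imp_strict_mono_on[OF assms(1)]]
      strict_chain_in_interval[OF assms(1)] assms(2)
    by (intro card_inj_on_le) auto
  then show ?thesis by simp
qed

lemma height_eq_0_iff: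
  fixes A :: "'a::{finite,bounded_lattice_bot}"
  shows "height A = 0 \<longleftrightarrow> A = bot"
proof -
  define L where "L = {m. \<exists>X. strict_chain bot A m X}"
  have height: "height A = Max L"
    by (simp add: height_def L_def strict_chain_def)
  have bound: "L \<subseteq> {..<card {bot..A}}"
    using strict_chain_length_less_card[OF _ finite] by (auto simp: L_def)
  then have "finite L" by (rule finite_subset) simp
  show ?thesis
  proof
    assume "height A = 0"
    show "A = bot"
    proof (rule ccontr)
      assume "A \<noteq> bot"
      then have "strict_chain bot A 1 (\<lambda>i. if i = 0 then bot else A)"
        by (simp add: strict_chain_def bot.not_eq_extremum)
      then have "1 \<in> L" by (auto simp: L_def)
      with \<open>finite L\<close> have "1 \<le> Max L" by (rule Max_ge)
      with \<open>height A = 0\<close> height show False by simp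
    qed
  next
    assume "A = bot"
    then have "strict_chain bot A 0 (\<lambda>_. bot)" by (simp add: strict_chain_def)
    moreover have "L \<subseteq> {0}" using bound \<open>A = bot\<close> by auto
    ultimately have "L = {0}" by (auto simp: L_def)
    then show "height A = 0" by (simp add: height)
  qed
qed

lemma ex_R1_iff:
  fixes r :: "'a::{finite,bounded_lattice_bot} \<Rightarrow> real"
  shows "(\<exists>t\<ge>0. R1 t r) \<longleftrightarrow> r bot = 0 \<and> (\<forall>A. 0 \<le> r A)"
proof
  assume "\<exists>t\<ge>0. R1 t r"
  then obtain t where "R1 t r" by blast
  moreover have "height (bot :: 'a) = 0" by (simp add: height_eq_0_iff)
  ultimately show "r bot = 0 \<and> (\<forall>A. 0 \<le> r A)"
    unfolding R1_def by (metis antisym mult_zero_right of_nat_0)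
next
  assume r: "r bot = 0 \<and> (\<forall>A. 0 \<le> r A)"
  define t where "t = Max (range r)"
  have r_le: "r A \<le> t" for A by (simp add: t_def)
  have "0 \<le> t" using r r_le[of bot] by simp
  have "r A \<le> t * real (height A)" for A
  proof (cases "A = bot")
    case True
    then show ?thesis using r \<open>0 \<le> t\<close> by simp
  next
    case False
    then have "1 \<le> real (height A)" using height_eq_0_iff[of A] by simp
    with \<open>0 \<le> t\<close> have "t \<le> t * real (height A)" by (simp add: mult_le_cancel_left1)
    with r_le show ?thesis by (rule order_trans)
  qed
  with r \<open>0 \<le> t\<close> show "\<exists>t\<ge>0. R1 t r" by (auto simp: R1_def)
qed

lemma rank_function_iff:
  "rank_function r \<longleftrightarrow> r bot = 0 \<and> R2 r \<and> R3 r"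
proof -
  have "\<forall>A. 0 \<le> r A" if "r bot = 0" "R2 r"
    using that unfolding R2_def by (metis bot_least)
  then show ?thesis unfolding rank_function_def ex_R1_iff by blast
qed

lemma maximal_chain_imp_strict_chain: "maximal_chain A B m X \<Longrightarrow> strict_chain A B m X"
  by (simp add: maximal_chain_def strict_chain_def covers_def)

lemma maximal_chain_imp_le:
  assumes "maximal_chain A B m X"
  shows "A \<le> B"
  using strict_chain_in_interval[OF maximal_chain_imp_strict_chain[OF assms], of m]
  by (auto intro: order_trans)

lemma maximal_chain_refl: "maximal_chain A A 0 (\<lambda>_. A)"
  by (simp add: maximal_chain_def)

lemma maximal_chain_snoc:
  assumes "maximal_chain A B m X" and "B \<lessdot> C"
  shows "maximal_chain A C (Suc m) (X(Suc m := C))"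
  using assms by (auto simp: maximal_chain_def)

lemma chain_weight_snoc:
  "chain_weight w (Suc m) (X(Suc m := C)) = chain_weight w m X + w (X m) C"
proof -
  have "(\<Sum>i=1..m. w ((X(Suc m := C)) (i - 1)) ((X(Suc m := C)) i)) = chain_weight w m X"
    unfolding chain_weight_def by (intro sum.cong) auto
  then show ?thesis by (simp add: chain_weight_def)
qed

lemma ex_cover_below:
  fixes A B :: "'a::order"
  assumes "A < B" and "finite {A..B}"
  obtains C where "A \<le> C" and "C \<lessdot> B"
proof -
  have "finite {A..<B}" using assms(2) by (rule finite_subset[rotated]) auto
  then obtain C where C: "C \<in> {A..<B}" and max: "\<And>D. D \<in> {A..<B} \<Longrightarrow> C \<le> D \<Longrightarrow> C = D"
    using finite_has_maximal[of "{A..<B}"] assms(1) by auto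
  have "\<not> (C < D \<and> D < B)" for D
    using C max[of D] by (auto intro: order_trans less_imp_le)
  then have "C \<lessdot> B" using C by (simp add: covers_def)
  moreover have "A \<le> C" using C by simp
  ultimately show thesis using that by blast
qed

lemma ex_maximal_chain:
  fixes A B :: "'a::order"
  assumes "A \<le> B" and "finite {A..B}"
  shows "\<exists>m X. maximal_chain A B m X"
  using assms
proof (induction "card {A..B}" arbitrary: B rule: less_induct)
  case less
  show ?case
  proof (cases "A = B")
    case True
    then show ?thesis using maximal_chain_refl by blast
  next
    case False
    then obtain C where C: "A \<le> C" "C \<lessdot> B"
      using less.prems by (metis ex_cover_below order_le_less)
    then have "{A..C} \<subset> {A..B}"
      using less.prems(1) by (auto simp: covers_def)
    with less.prems(2) have "card {A..C} < card {A..B}" "finite {A..C}"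
      by (auto intro: psubset_card_mono finite_subset)
    with less.hyps C show ?thesis using maximal_chain_snoc by blast
  qed
qed

lemma interval_weight_eq_chain_weight:
  assumes "IW1 w" and "maximal_chain A B m X"
  shows "interval_weight w A B = chain_weight w m X"
  unfolding interval_weight_def
  using assms maximal_chain_imp_le[OF assms(2)] unfolding IW1_def
  by (intro the_equality) blast+

lemma ex1_chain_weight:
  assumes "IW1 w" and "A \<le> B" and "finite {A..B}"
  shows "\<exists>!s. \<exists>m X. maximal_chain A B m X \<and> s = chain_weight w m X"
  using ex_maximal_chain[OF assms(2,3)] interval_weight_eq_chain_weight[OF assms(1)] by metis

lemma interval_weight_refl:
  assumes "IW1 w"
  shows "interval_weight w A A = 0"
  using interval_weight_eq_chain_weight[OF assms maximal_chain_refl]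
  by (simp add: chain_weight_def)

lemma interval_weight_snoc:
  assumes "IW1 w" and "A \<le> B" and "finite {A..B}" and "B \<lessdot> C"
  shows "interval_weight w A C = interval_weight w A B + w B C"
proof -
  obtain m X where X: "maximal_chain A B m X"
    using ex_maximal_chain[OF assms(2,3)] by blast
  have "interval_weight w A C = chain_weight w (Suc m) (X(Suc m := C))"
    using assms(1) maximal_chain_snoc[OF X assms(4)] by (rule interval_weight_eq_chain_weight)
  also have "\<dots> = chain_weight w m X + w B C"
    using X by (simp add: chain_weight_snoc maximal_chain_def)
  also have "chain_weight w m X = interval_weight w A B"
    using interval_weight_eq_chain_weight[OF assms(1) X] by simp
  finally show ?thesis .
qed

lemma rank_of_weight_eq_interval_weight: "rank_of_weight w = interval_weight w bot"
  by (simp add: fun_eq_iff rank_of_weight_def interval_weight_def)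

definition is_potential :: "('a::order \<Rightarrow> real) \<Rightarrow> ('a \<Rightarrow> 'a \<Rightarrow> real) \<Rightarrow> bool" where
  "is_potential r w \<longleftrightarrow> (\<forall>A B. A \<lessdot> B \<longrightarrow> w A B = weight_of_rank r A B)"

lemma is_potential_weight_of_rank: "is_potential r (weight_of_rank r)"
  by (simp add: is_potential_def)

lemma is_potential_rank_of_weight:
  fixes w :: "'a::bounded_lattice_bot \<Rightarrow> 'a \<Rightarrow> real"
  assumes "IW1 w" and "\<And>A::'a. finite {bot..A}"
  shows "is_potential (rank_of_weight w) w"
  using interval_weight_snoc[OF assms(1) bot_least assms(2)]
  by (simp add: is_potential_def weight_of_rank_def rank_of_weight_eq_interval_weight)

lemma chain_weight_potential:
  assumes "is_potential r w" and "maximal_chain A B m X"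
  shows "chain_weight w m X = r B - r A"
proof -
  have "chain_weight w m X = (\<Sum>i=1..m. r (X i) - r (X (i - 1)))"
    using assms unfolding chain_weight_def maximal_chain_def
    by (intro sum.cong) (auto simp: is_potential_def weight_of_rank_def)
  also have "\<dots> = r (X m) - r (X 0)"
    using sum_telescope''[of 0 m "\<lambda>i. r (X i)"] by simp
  finally show ?thesis using assms(2) by (simp add: maximal_chain_def)
qed

lemma IW1_if_potential: "is_potential r w \<Longrightarrow> IW1 w"
  unfolding IW1_def using chain_weight_potential by metis

lemma interval_weight_potential:
  assumes "is_potential r w" and "A \<le> B" and "finite {A..B}"
  shows "interval_weight w A B = r B - r A"
proof -
  obtain m X where X: "maximal_chain A B m X"
    using ex_maximal_chain[OF assms(2,3)] by blast
  have "interval_weight w A B = chain_weight w m X"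
    using IW1_if_potential[OF assms(1)] X by (rule interval_weight_eq_chain_weight)
  also have "\<dots> = r B - r A"
    using assms(1) X by (rule chain_weight_potential)
  finally show ?thesis .
qed

lemma rank_of_weight_eq_potential:
  fixes r :: "'a::bounded_lattice_bot \<Rightarrow> real"
  assumes "is_potential r w" and "r bot = 0" and "\<And>A::'a. finite {bot..A}"
  shows "rank_of_weight w = r"
  using interval_weight_potential[OF assms(1) bot_least assms(3)] assms(2)
  by (simp add: fun_eq_iff rank_of_weight_eq_interval_weight)

lemma cover_weighted_iff_R2:
  fixes r :: "'a::lattice \<Rightarrow> real"
  assumes "is_potential r w" and "\<And>A B::'a. finite {A..B}"
  shows "cover_weighted w \<longleftrightarrow> R2 r"
proof
  assume w: "cover_weighted w"
  show "R2 r"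
    unfolding R2_def
  proof (intro allI impI)
    fix A B :: 'a assume "A \<le> B"
    then obtain m X where X: "maximal_chain A B m X"
      using ex_maximal_chain assms(2) by blast
    have "0 \<le> chain_weight w m X"
      using X w unfolding chain_weight_def maximal_chain_def cover_weighted_def
      by (intro sum_nonneg) auto
    then show "r A \<le> r B" using chain_weight_potential[OF assms(1) X] by simp
  qed
next
  assume "R2 r"
  with assms(1) show "cover_weighted w"
    unfolding cover_weighted_def R2_def is_potential_def weight_of_rank_def covers_def
    by (simp add: less_imp_le)
qed

lemma IW2_iff_R3:
  fixes r :: "'a::lattice \<Rightarrow> real"
  assumes "is_potential r w" and "\<And>A B::'a. finite {A..B}"
  shows "IW2 w \<longleftrightarrow> R3 r"
proof -
  have "interval_weight w A (sup X A) \<le> interval_weight w (inf A X) X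
      \<longleftrightarrow> r X - r (inf X A) \<ge> r (sup X A) - r A" for A X
    by (simp add: interval_weight_potential[OF assms(1) _ assms(2)] inf_commute)
  then show ?thesis
    using IW1_if_potential[OF assms(1)] unfolding IW2_def R3_def by blast
qed

lemma rank_function_potential_iff:
  assumes "is_potential r w"
  shows "rank_function r \<longleftrightarrow> r bot = 0 \<and> cover_weighted w \<and> IW2 w"
  using cover_weighted_iff_R2[OF assms finite] IW2_iff_R3[OF assms finite]
  by (simp add: rank_function_iff)

theorem theorem3p3:
  fixes w :: "'a::{finite,bounded_lattice_bot} \<Rightarrow> 'a \<Rightarrow> real"
  assumes "cover_weighted w"
  shows
    "(\<forall>r :: 'a \<Rightarrow> real. rank_function r \<longrightarrow>
        cover_weighted (weight_of_rank r) \<and> IW1 (weight_of_rank r) \<and> IW2 (weight_of_rank r)) \<and>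
     (IW1 w \<and> IW2 w \<longrightarrow>
        (\<forall>A. \<exists>!s. \<exists>m X. maximal_chain bot A m X \<and> s = chain_weight w m X) \<and>
        rank_function (rank_of_weight w)) \<and>
     (IW1 w \<and> IW2 w \<longrightarrow>
        (\<forall>A B. A \<lessdot> B \<longrightarrow> weight_of_rank (rank_of_weight w) A B = w A B)) \<and>
     (\<forall>r :: 'a \<Rightarrow> real. rank_function r \<longrightarrow> rank_of_weight (weight_of_rank r) = r)"
proof (intro conjI allI impI; (elim conjE)?)
  fix r :: "'a \<Rightarrow> real" assume r: "rank_function r"
  note potential = is_potential_weight_of_rank[of r]
  show "cover_weighted (weight_of_rank r)" "IW2 (weight_of_rank r)"
    using r rank_function_potential_iff[OF potential] by simp_all
  show "IW1 (weight_of_rank r)" using potential by (rule IW1_if_potential)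
  show "rank_of_weight (weight_of_rank r) = r"
    using potential r by (simp add: rank_of_weight_eq_potential rank_function_iff)
next
  fix A :: 'a assume "IW1 w"
  then show "\<exists>!s. \<exists>m X. maximal_chain bot A m X \<and> s = chain_weight w m X"
    by (intro ex1_chain_weight) simp_all
next
  assume "IW1 w" "IW2 w"
  moreover have "rank_of_weight w bot = 0"
    using \<open>IW1 w\<close> by (simp add: rank_of_weight_eq_interval_weight interval_weight_refl)
  ultimately show "rank_function (rank_of_weight w)"
    using assms rank_function_potential_iff[OF is_potential_rank_of_weight[OF _ finite]] by blast
next
  fix A B :: 'a assume "IW1 w" "A \<lessdot> B"
  then show "weight_of_rank (rank_of_weight w) A B = w A B"
    using is_potential_rank_of_weight[of w] by (simp add: is_potential_def)
qed

end
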